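(* Let $n\ge1$ and let $D^X,D^Y\in M^{(n)}_{\leq}$ be of negative type. Define $h:\mathcal{B}_n\to\mathbb{R}$ by $h(P)=\sum_{i,j,k,l=1}^n D^X_{ij}D^Y_{kl}\,p_{ik}\,p_{jl}$ for $P=(p_{ij})\in\mathcal{B}_n$. Then $$\max_{\mathcal{B}_n}h=\max_{\operatorname{ext}(\mathcal{B}_n)}h.$$
   Context: $M^{(n)}_{\leq}$ is the set of real symmetric $n\times n$ matrices $D$ with zero diagonal satisfying $D_{ij}\le D_{ik}+D_{kj}$ for all $i,j,k\in\{1,\dots,n\}$ (distance matrices of $n$-point pseudo-metric spaces). $D\in M^{(n)}_{\leq}$ is of negative type if for all $v\in\mathbb{R}^n$ with $\sum_{i=1}^n v_i=0$ one has $v^TDv\le0$. $\mathcal{B}_n$ is the set of $n\times n$ bistochastic matrices (nonnegative entries, every row and every column summing to $1$), and $\operatorname{ext}(\mathcal{B}_n)$ is its set of extreme points, which by the Birkhoff–von Neumann theorem is exactly the set of permutation matrices. *)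

theory Defs
  imports "HOL-Analysis.Analysis"
begin

definition pseudo_dist_matrices :: "(real^'n^'n) set" where
  "pseudo_dist_matrices =
     {D. transpose D = D \<and> (\<forall>i. D $ i $ i = 0) \<and>
         (\<forall>i j k. D $ i $ j \<le> D $ i $ k + D $ k $ j)}"

definition negative_type :: "real^'n^'n \<Rightarrow> bool" where
  "negative_type D \<longleftrightarrow> (\<forall>v :: real^'n. (\<Sum>i\<in>UNIV. v $ i) = 0 \<longrightarrow> v \<bullet> (D *v v) \<le> 0)"

definition bistochastic :: "(real^'n^'n) set" where
  "bistochastic =
     {P. (\<forall>i j. 0 \<le> P $ i $ j) \<and>
         (\<forall>i. (\<Sum>j\<in>UNIV. P $ i $ j) = 1) \<and>
         (\<forall>j. (\<Sum>i\<in>UNIV. P $ i $ j) = 1)}"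

definition extreme_points :: "'a::real_vector set \<Rightarrow> 'a set" where
  "extreme_points S = {x. x extreme_point_of S}"

definition gw_functional :: "real^'n^'n \<Rightarrow> real^'n^'n \<Rightarrow> real^'n^'n \<Rightarrow> real" where
  "gw_functional DX DY P =
     (\<Sum>i\<in>UNIV. \<Sum>j\<in>UNIV. \<Sum>k\<in>UNIV. \<Sum>l\<in>UNIV.
        DX $ i $ j * DY $ k $ l * P $ i $ k * P $ j $ l)"

text \<open>
  The maximum is a relation, so that asserting it includes that the value is attained;
  \<open>Max\<close> is unspecified on infinite sets and \<open>Sup\<close> need not be attained.
\<close>
definition has_maximum_on :: "('a \<Rightarrow> real) \<Rightarrow> 'a set \<Rightarrow> real \<Rightarrow> bool" where
  "has_maximum_on f S m \<longleftrightarrow> (\<exists>x\<in>S. f x = m) \<and> (\<forall>x\<in>S. f x \<le> m)"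

end

theory Submission
  imports Defs
begin

text \<open>
  The functional is convex on bistochastic matrices, and a continuous convex function on a compact
  convex set attains its maximum at an extreme point.

  Being quadratic, the functional is convex along the segment from \<open>P\<close> to \<open>R\<close> as soon as it is
  nonnegative at \<open>Q = P - R\<close>, a matrix all of whose rows and columns sum to \<open>0\<close>
  (lemma \<open>gw_functional_segment\<close>). To see this nonnegativity, fix a base point \<open>r\<close>. Negative type of
  \<open>D\<^sup>X\<close> says that \<open>K\<^sub>i\<^sub>j = (D\<^sup>X\<^sub>i\<^sub>r + D\<^sup>X\<^sub>j\<^sub>r - D\<^sup>X\<^sub>i\<^sub>j) / 2\<close> is a positive semidefinite
  kernel, hence a Gram kernel \<open>\<Sum>\<^sub>m f\<^sub>m(i) f\<^sub>m(j)\<close> (lemma \<open>psd_kernel_is_gram\<close>). Since the columns of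
  \<open>Q\<close> sum to \<open>0\<close>, replacing \<open>D\<^sup>X\<close> by \<open>-2 K\<close> does not change the functional at \<open>Q\<close>, which therefore
  equals \<open>-2 \<Sum>\<^sub>m u\<^sub>m\<^sup>T D\<^sup>Y u\<^sub>m\<close> with \<open>u\<^sub>m = Q\<^sup>T f\<^sub>m\<close>. The rows of \<open>Q\<close> sum to \<open>0\<close>, so the entries of each
  \<open>u\<^sub>m\<close> do too, and negative type of \<open>D\<^sup>Y\<close> gives \<open>u\<^sub>m\<^sup>T D\<^sup>Y u\<^sub>m \<le> 0\<close>.
\<close>

section \<open>Positive semidefinite kernels\<close>

text \<open>
  This is Cholesky elimination: adjoining a point \<open>a\<close> to the index set, one subtracts the rank-one
  kernel that agrees with \<open>K\<close> on the row and column of \<open>a\<close>, and the remaining Schur complement is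
  again positive semidefinite on the other points.
\<close>
lemma psd_kernel_is_gram:
  fixes K :: "'a \<Rightarrow> 'a \<Rightarrow> real"
  assumes "finite I"
    and "\<And>i j. i \<in> I \<Longrightarrow> j \<in> I \<Longrightarrow> K i j = K j i"
    and "\<And>c. 0 \<le> (\<Sum>i\<in>I. \<Sum>j\<in>I. c i * c j * K i j)"
  shows "\<exists>f. \<forall>i\<in>I. \<forall>j\<in>I. K i j = (\<Sum>m\<in>I. f m i * f m j)"
  using assms
proof (induction I arbitrary: K rule: finite_induct)
  case empty
  then show ?case by simp
next
  case (insert a I)
  note sym = insert.prems(1)
  have quadratic: "0 \<le> K a a * x\<^sup>2 + 2 * x * (\<Sum>i\<in>I. c i * K a i)
      + (\<Sum>i\<in>I. \<Sum>j\<in>I. c i * c j * K i j)" for x c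
  proof -
    define d where "d = c(a := x)"
    have da: "d a = x" and dI: "\<And>i. i \<in> I \<Longrightarrow> d i = c i"
      using insert.hyps by (auto simp: d_def)
    have "0 \<le> (\<Sum>i\<in>insert a I. \<Sum>j\<in>insert a I. d i * d j * K i j)"
      by (rule insert.prems(2))
    also have "\<dots> = x * x * K a a + (\<Sum>j\<in>I. x * c j * K a j)
        + (\<Sum>i\<in>I. c i * x * K i a + (\<Sum>j\<in>I. c i * c j * K i j))"
      using insert.hyps by (simp add: da dI)
    also have "(\<Sum>i\<in>I. c i * x * K i a + (\<Sum>j\<in>I. c i * c j * K i j))
        = (\<Sum>i\<in>I. x * c i * K a i) + (\<Sum>i\<in>I. \<Sum>j\<in>I. c i * c j * K i j)"
      using sym by (simp add: sum.distrib mult_ac)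
    finally show ?thesis
      by (simp add: sum_distrib_left power2_eq_square algebra_simps)
  qed
  have diag: "0 \<le> K a a"
    using quadratic[of 1 "\<lambda>_. 0"] by simp
  \<comment> \<open>If the coefficient of \<open>x\<^sup>2\<close> vanishes, then so must that of \<open>x\<close>.\<close>
  have isotropic: "K a i = 0" if "K a a = 0" "i \<in> I" for i
  proof (rule ccontr)
    assume nz: "K a i \<noteq> 0"
    have nonneg: "0 \<le> 2 * x * K a i + K i i" for x
      using quadratic[of x "\<lambda>j. if j = i then 1 else 0"] that insert.hyps
      by (simp add: mult_delta_left mult_delta_right mult.assoc sum_distrib_left[symmetric])
    show False
      using nonneg[of "- (K i i + 1) / (2 * K a i)"] nz by (simp add: field_simps)
  qed
  \<comment> \<open>When \<open>K a a = 0\<close> this divides by \<open>0\<close> and so gives \<open>0\<close>, the correct value by the previous fact.\<close>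
  define g where "g i = K a i / sqrt (K a a)" for i
  define K' where "K' i j = K i j - g i * g j" for i j
  have g_prod: "g i * g j = K a i * K a j / K a a" for i j
    using diag by (simp add: g_def)
  have "\<exists>f. \<forall>i\<in>I. \<forall>j\<in>I. K' i j = (\<Sum>m\<in>I. f m i * f m j)"
  proof (rule insert.IH)
    fix i j assume "i \<in> I" "j \<in> I"
    then show "K' i j = K' j i" using sym by (simp add: K'_def)
  next
    fix c
    define S where "S = (\<Sum>i\<in>I. c i * K a i)"
    define T where "T = (\<Sum>i\<in>I. \<Sum>j\<in>I. c i * c j * K i j)"
    have "(\<Sum>i\<in>I. \<Sum>j\<in>I. c i * c j * K' i j)
        = T - (\<Sum>i\<in>I. \<Sum>j\<in>I. (c i * K a i) * (c j * K a j)) / K a a"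
      by (simp add: K'_def g_prod T_def sum_subtractf right_diff_distrib sum_divide_distrib mult_ac)
    also have "\<dots> = T - S\<^sup>2 / K a a"
      by (simp add: S_def power2_eq_square sum_product)
    also have "\<dots> \<ge> 0"
      \<comment> \<open>For \<open>K a a > 0\<close> the minimum of the quadratic polynomial in \<open>x\<close> is at \<open>x = - S / K a a\<close>.\<close>
      using quadratic[of "- S / K a a" c] diag unfolding S_def[symmetric] T_def[symmetric]
      by (cases "K a a = 0") (simp_all add: power2_eq_square)
    finally show "0 \<le> (\<Sum>i\<in>I. \<Sum>j\<in>I. c i * c j * K' i j)" .
  qed
  then obtain f where f: "\<And>i j. i \<in> I \<Longrightarrow> j \<in> I \<Longrightarrow> K' i j = (\<Sum>m\<in>I. f m i * f m j)"
    by blast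
  define F where "F m i = (if m = a then g i else if i = a then 0 else f m i)" for m i
  have ga: "g a * g i = K a i" if "i \<in> insert a I" for i
    using that isotropic by (auto simp: g_prod)
  have ga': "g i * g a = K a i" if "i \<in> insert a I" for i
    using ga[OF that] by (simp only: mult.commute)
  have Fa: "F a i = g i" for i by (simp add: F_def)
  have FI: "(\<Sum>m\<in>I. F m i * F m j) = (if i = a \<or> j = a then 0 else \<Sum>m\<in>I. f m i * f m j)" for i j
  proof -
    have "(\<Sum>m\<in>I. F m i * F m j) = (\<Sum>m\<in>I. if i = a \<or> j = a then 0 else f m i * f m j)"
      using insert.hyps by (intro sum.cong) (auto simp: F_def)
    then show ?thesis by simp
  qed
  have "K i j = (\<Sum>m\<in>insert a I. F m i * F m j)" if "i \<in> insert a I" "j \<in> insert a I" for i j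
  proof (cases "i = a \<or> j = a")
    case True
    then show ?thesis
      using insert.hyps ga[OF that(2)] ga'[OF that(1)] sym[OF that] by (auto simp: Fa FI)
  next
    case False
    then have "K i j = g i * g j + K' i j" by (simp add: K'_def)
    with False that insert.hyps f show ?thesis by (simp add: Fa FI)
  qed
  then show ?case by blast
qed

section \<open>Matrices of negative type\<close>

lemma inner_matrix_vector_sum:
  fixes D :: "real^'n^'n"
  shows "v \<bullet> (D *v v) = (\<Sum>i\<in>UNIV. \<Sum>j\<in>UNIV. D $ i $ j * v $ i * v $ j)"
  by (simp add: inner_vec_def matrix_vector_mult_def sum_distrib_left mult_ac)

text \<open>
  The kernel is the inner product of \<open>i\<close> and \<open>j\<close> seen from \<open>r\<close> when \<open>D\<close> is read as a squared Euclidean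
  distance. Its quadratic form at \<open>c\<close> is \<open>- 1/2\<close> times that of \<open>D\<close> at the vector obtained from \<open>c\<close> by
  changing the entry at \<open>r\<close> so that the entries sum to \<open>0\<close>.
\<close>
lemma negative_type_gram:
  fixes D :: "real^'n^'n"
  assumes sym: "\<And>i j. D $ i $ j = D $ j $ i" and diag: "\<And>i. D $ i $ i = 0"
    and neg: "negative_type D"
  shows "\<exists>f :: 'n \<Rightarrow> 'n \<Rightarrow> real.
    \<forall>i j. D $ i $ j = D $ i $ r + D $ j $ r - 2 * (\<Sum>m\<in>UNIV. f m i * f m j)"
proof -
  define K where "K i j = (D $ i $ r + D $ j $ r - D $ i $ j) / 2" for i j
  have "\<exists>f :: 'n \<Rightarrow> 'n \<Rightarrow> real. \<forall>i\<in>UNIV. \<forall>j\<in>UNIV. K i j = (\<Sum>m\<in>UNIV. f m i * f m j)"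
  proof (rule psd_kernel_is_gram)
    fix c :: "'n \<Rightarrow> real"
    define s where "s = (\<Sum>i\<in>UNIV. c i)"
    define e where "e i = (if i = r then s else 0)" for i
    define v :: "real^'n" where "v = (\<chi> i. c i - e i)"
    define A where "A = (\<Sum>i\<in>UNIV. c i * D $ i $ r)"
    define B where "B = (\<Sum>i\<in>UNIV. \<Sum>j\<in>UNIV. c i * c j * D $ i $ j)"
    have "(\<Sum>i\<in>UNIV. v $ i) = 0"
      by (simp add: v_def e_def sum_subtractf s_def)
    then have "v \<bullet> (D *v v) \<le> 0"
      using neg by (simp add: negative_type_def)
    moreover have "v \<bullet> (D *v v) = B - 2 * s * A"
    proof -
      have at_r: "(\<Sum>j\<in>UNIV. X j * e j) = X r * s" for X :: "'n \<Rightarrow> real"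
        by (simp add: e_def mult_delta_right)
      have "v \<bullet> (D *v v) = (\<Sum>i\<in>UNIV. \<Sum>j\<in>UNIV.
          c i * c j * D $ i $ j - c i * (D $ i $ j * e j)
          - D $ i $ j * c j * e i + D $ i $ j * e j * e i)"
        unfolding inner_matrix_vector_sum v_def by (simp add: algebra_simps)
      also have "\<dots> = B - (\<Sum>i\<in>UNIV. c i * (\<Sum>j\<in>UNIV. D $ i $ j * e j))
          - (\<Sum>i\<in>UNIV. (\<Sum>j\<in>UNIV. D $ i $ j * c j) * e i)
          + (\<Sum>i\<in>UNIV. (\<Sum>j\<in>UNIV. D $ i $ j * e j) * e i)"
        by (simp add: sum.distrib sum_subtractf B_def sum_distrib_left sum_distrib_right)
      also have "\<dots> = B - A * s - (\<Sum>j\<in>UNIV. D $ r $ j * c j) * s + D $ r $ r * s * s"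
        unfolding at_r A_def by (simp add: sum_distrib_right mult.assoc)
      also have "(\<Sum>j\<in>UNIV. D $ r $ j * c j) = A"
        unfolding A_def by (intro sum.cong) (auto simp: sym[of r])
      finally show ?thesis by (simp add: diag)
    qed
    moreover have "(\<Sum>i\<in>UNIV. \<Sum>j\<in>UNIV. c i * c j * K i j) = s * A - B / 2"
    proof -
      have "(\<Sum>i\<in>UNIV. \<Sum>j\<in>UNIV. c i * c j * K i j)
          = (\<Sum>i\<in>UNIV. \<Sum>j\<in>UNIV. c j * (c i * D $ i $ r) / 2 + c i * (c j * D $ j $ r) / 2
              - c i * c j * D $ i $ j / 2)"
        unfolding K_def by (intro sum.cong refl) (simp add: field_simps)
      also have "\<dots> = s * A / 2 + s * A / 2 - B / 2"
        by (simp add: sum.distrib sum_subtractf B_def A_def s_def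
            sum_divide_distrib[symmetric] sum_distrib_left[symmetric] sum_distrib_right[symmetric])
      finally show ?thesis by simp
    qed
    ultimately show "0 \<le> (\<Sum>i\<in>UNIV. \<Sum>j\<in>UNIV. c i * c j * K i j)" by simp
  qed (auto simp: K_def sym)
  then obtain f :: "'n \<Rightarrow> 'n \<Rightarrow> real" where f: "\<And>i j. K i j = (\<Sum>m\<in>UNIV. f m i * f m j)" by blast
  show ?thesis
    by (rule exI[of _ f]) (simp add: f[symmetric] K_def field_simps)
qed

section \<open>Convexity of the functional\<close>

lemma sum_rotate:
  fixes F :: "'a \<Rightarrow> 'b \<Rightarrow> 'c \<Rightarrow> 'd::comm_monoid_add"
  shows "(\<Sum>i\<in>A. \<Sum>j\<in>B. \<Sum>m\<in>C. F i j m) = (\<Sum>m\<in>C. \<Sum>i\<in>A. \<Sum>j\<in>B. F i j m)"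
proof -
  have "(\<Sum>i\<in>A. \<Sum>j\<in>B. \<Sum>m\<in>C. F i j m) = (\<Sum>i\<in>A. \<Sum>m\<in>C. \<Sum>j\<in>B. F i j m)"
    by (intro sum.cong refl sum.swap)
  also have "\<dots> = (\<Sum>m\<in>C. \<Sum>i\<in>A. \<Sum>j\<in>B. F i j m)"
    by (rule sum.swap)
  finally show ?thesis .
qed

text \<open>
  The hypotheses on \<open>Q\<close> hold for the difference of two bistochastic matrices. The terms of \<open>DX\<close>
  that depend on one index only cancel against the columns of \<open>Q\<close>; the Gram part turns the functional
  into a sum of quadratic forms of \<open>DY\<close> at vectors with entries summing to \<open>0\<close>.
\<close>
lemma gw_functional_nonneg:
  fixes DX DY Q :: "real^'n^'n"
  assumes DX: "\<And>i j. DX $ i $ j = DX $ j $ i" "\<And>i. DX $ i $ i = 0" "negative_type DX"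
    and DY: "negative_type DY"
    and rows: "\<And>i. (\<Sum>j\<in>UNIV. Q $ i $ j) = 0" and cols: "\<And>j. (\<Sum>i\<in>UNIV. Q $ i $ j) = 0"
  shows "0 \<le> gw_functional DX DY Q"
proof -
  obtain r :: 'n where True by simp
  obtain f :: "'n \<Rightarrow> 'n \<Rightarrow> real"
    where f: "\<And>i j. DX $ i $ j = DX $ i $ r + DX $ j $ r - 2 * (\<Sum>m\<in>UNIV. f m i * f m j)"
    using negative_type_gram[OF DX, of r] by blast
  define u :: "'n \<Rightarrow> real^'n" where "u m = (\<chi> k. \<Sum>i\<in>UNIV. f m i * Q $ i $ k)" for m
  have contract: "(\<Sum>i\<in>UNIV. \<Sum>j\<in>UNIV. DX $ i $ j * (Q $ i $ k * Q $ j $ l))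
      = - 2 * (\<Sum>m\<in>UNIV. u m $ k * u m $ l)" for k l
  proof -
    have summand: "DX $ i $ j * (Q $ i $ k * Q $ j $ l) =
          (DX $ i $ r * Q $ i $ k) * Q $ j $ l + Q $ i $ k * (DX $ j $ r * Q $ j $ l)
          - 2 * (\<Sum>m\<in>UNIV. (f m i * Q $ i $ k) * (f m j * Q $ j $ l))" for i j
    proof -
      have "(\<Sum>m\<in>UNIV. (f m i * Q $ i $ k) * (f m j * Q $ j $ l))
          = (\<Sum>m\<in>UNIV. f m i * f m j) * (Q $ i $ k * Q $ j $ l)"
        unfolding sum_distrib_right by (simp add: mult_ac)
      then show ?thesis
        unfolding f[of i j] by (simp add: algebra_simps)
    qed
    have "(\<Sum>i\<in>UNIV. \<Sum>j\<in>UNIV. DX $ i $ j * (Q $ i $ k * Q $ j $ l))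
      = (\<Sum>i\<in>UNIV. \<Sum>j\<in>UNIV. (DX $ i $ r * Q $ i $ k) * Q $ j $ l
          + Q $ i $ k * (DX $ j $ r * Q $ j $ l)
          - 2 * (\<Sum>m\<in>UNIV. (f m i * Q $ i $ k) * (f m j * Q $ j $ l)))"
      by (simp only: summand)
    also have "\<dots> = - 2 * (\<Sum>i\<in>UNIV. \<Sum>j\<in>UNIV. \<Sum>m\<in>UNIV.
        (f m i * Q $ i $ k) * (f m j * Q $ j $ l))"
      by (simp add: sum.distrib sum_subtractf sum_distrib_left[symmetric]
          sum_distrib_right[symmetric] rows cols)
    also have "(\<Sum>i\<in>UNIV. \<Sum>j\<in>UNIV. \<Sum>m\<in>UNIV. (f m i * Q $ i $ k) * (f m j * Q $ j $ l))
        = (\<Sum>m\<in>UNIV. \<Sum>i\<in>UNIV. \<Sum>j\<in>UNIV. (f m i * Q $ i $ k) * (f m j * Q $ j $ l))"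
      by (rule sum_rotate)
    also have "\<dots> = (\<Sum>m\<in>UNIV. u m $ k * u m $ l)"
      by (simp add: u_def sum_product)
    finally show ?thesis .
  qed
  have "gw_functional DX DY Q
      = (\<Sum>k\<in>UNIV. \<Sum>l\<in>UNIV. \<Sum>i\<in>UNIV. \<Sum>j\<in>UNIV.
          DX $ i $ j * DY $ k $ l * Q $ i $ k * Q $ j $ l)"
    unfolding gw_functional_def sum.cartesian_product
    by (rule sum.reindex_bij_witness[where i = "\<lambda>(k,l,i,j). (i,j,k,l)" and j = "\<lambda>(i,j,k,l). (k,l,i,j)"])
      auto
  also have "\<dots> = (\<Sum>k\<in>UNIV. \<Sum>l\<in>UNIV. DY $ k $ l *
      (\<Sum>i\<in>UNIV. \<Sum>j\<in>UNIV. DX $ i $ j * (Q $ i $ k * Q $ j $ l)))"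
    unfolding sum_distrib_left by (simp add: mult_ac)
  also have "\<dots> = (\<Sum>k\<in>UNIV. \<Sum>l\<in>UNIV. \<Sum>m\<in>UNIV. - 2 * (DY $ k $ l * u m $ k * u m $ l))"
    unfolding contract sum_distrib_left by (simp add: mult_ac)
  also have "\<dots> = (\<Sum>m\<in>UNIV. \<Sum>k\<in>UNIV. \<Sum>l\<in>UNIV. - 2 * (DY $ k $ l * u m $ k * u m $ l))"
    by (rule sum_rotate)
  also have "\<dots> = - 2 * (\<Sum>m\<in>UNIV. u m \<bullet> (DY *v u m))"
    by (simp add: inner_matrix_vector_sum sum_distrib_left)
  also have "\<dots> \<ge> 0"
  proof -
    have "u m \<bullet> (DY *v u m) \<le> 0" for m
    proof -
      have "(\<Sum>k\<in>UNIV. u m $ k) = (\<Sum>k\<in>UNIV. \<Sum>i\<in>UNIV. f m i * Q $ i $ k)"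
        by (simp add: u_def)
      also have "\<dots> = (\<Sum>i\<in>UNIV. f m i * (\<Sum>k\<in>UNIV. Q $ i $ k))"
        unfolding sum_distrib_left by (rule sum.swap)
      also have "\<dots> = 0" by (simp add: rows)
      finally show ?thesis using DY unfolding negative_type_def by blast
    qed
    then have "(\<Sum>m\<in>UNIV. u m \<bullet> (DY *v u m)) \<le> 0" by (intro sum_nonpos)
    then show ?thesis by linarith
  qed
  finally show ?thesis .
qed

text \<open>
  The functional is a quadratic form, and for \<open>a = 1 - b\<close> a product satisfies
  \<open>(a p + b q) (a p' + b q') = a p p' + b q q' - a b (p - q) (p' - q')\<close>. Hence convexity on a set
  amounts to nonnegativity at the differences of its points.
\<close>
lemma gw_functional_segment:
  assumes "a + b = 1"
  shows "gw_functional DX DY (a *\<^sub>R P + b *\<^sub>R R)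
      = a * gw_functional DX DY P + b * gw_functional DX DY R - a * b * gw_functional DX DY (P - R)"
proof -
  have a: "a = 1 - b" using assms by simp
  have summand: "d * e * (a * p + b * q) * (a * p' + b * q')
      = a * (d * e * p * p') + b * (d * e * q * q') - a * b * (d * e * (p - q) * (p' - q'))"
    for d e p q p' q' :: real
    unfolding a by (simp add: algebra_simps)
  show ?thesis
    unfolding gw_functional_def
    by (simp only: summand vector_add_component vector_scaleR_component vector_minus_component
        real_scaleR_def sum.distrib sum_subtractf sum_distrib_left)
qed

section \<open>The polytope of bistochastic matrices\<close>

lemma convex_bistochastic: "convex (bistochastic :: (real^'n^'n) set)"
proof (rule convexI)
  fix P R :: "real^'n^'n" and a b :: real
  assume "P \<in> bistochastic" "R \<in> bistochastic" "0 \<le> a" "0 \<le> b" "a + b = 1"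
  then show "a *\<^sub>R P + b *\<^sub>R R \<in> bistochastic"
    by (simp add: bistochastic_def sum.distrib sum_distrib_left[symmetric])
qed

lemma compact_bistochastic: "compact (bistochastic :: (real^'n^'n) set)"
proof -
  have "closed (bistochastic :: (real^'n^'n) set)"
    unfolding bistochastic_def
    by (intro closed_Collect_conj closed_Collect_all closed_Collect_le closed_Collect_eq
        continuous_intros)
  moreover have "bounded (bistochastic :: (real^'n^'n) set)"
  proof (rule boundedI)
    fix P :: "real^'n^'n"
    assume P: "P \<in> bistochastic"
    have row: "norm (P $ i) \<le> 1" for i
    proof -
      have "norm (P $ i) \<le> (\<Sum>j\<in>UNIV. \<bar>P $ i $ j\<bar>)" by (rule norm_le_l1_cart)
      also have "\<dots> = 1" using P by (simp add: bistochastic_def)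
      finally show ?thesis .
    qed
    have "norm P \<le> (\<Sum>i\<in>UNIV. norm (P $ i))"
      unfolding norm_vec_def[of P] by (rule L2_set_le_sum) simp
    also have "\<dots> \<le> (\<Sum>i\<in>(UNIV :: 'n set). 1)" by (intro sum_mono row)
    finally show "norm P \<le> real CARD('n)" by simp
  qed
  ultimately show ?thesis by (simp add: compact_eq_bounded_closed)
qed

lemma mat_1_in_bistochastic: "(mat 1 :: real^'n^'n) \<in> bistochastic"
  by (simp add: bistochastic_def mat_def)

theorem corollary4p13:
  fixes DX DY :: "real^'n^'n"
  assumes "DX \<in> pseudo_dist_matrices" and "DY \<in> pseudo_dist_matrices"
    and "negative_type DX" and "negative_type DY"
  shows "\<exists>m. has_maximum_on (gw_functional DX DY) bistochastic m \<and>
             has_maximum_on (gw_functional DX DY) (extreme_points bistochastic) m"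
proof -
  let ?h = "gw_functional DX DY" and ?B = "bistochastic :: (real^'n^'n) set"
  have DX: "transpose DX = DX" "\<forall>i. DX $ i $ i = 0"
    using assms(1) unfolding pseudo_dist_matrices_def by blast+
  have sym: "DX $ i $ j = DX $ j $ i" for i j
    by (subst DX(1)[symmetric]) (simp only: transpose_def vec_lambda_beta)
  have diag: "DX $ i $ i = 0" for i
    using DX(2) by blast
  have "continuous_on ?B ?h"
    unfolding gw_functional_def by (intro continuous_intros)
  then obtain P where P: "P \<in> ?B" "\<And>R. R \<in> ?B \<Longrightarrow> ?h R \<le> ?h P"
    using continuous_attains_sup[OF compact_bistochastic] mat_1_in_bistochastic by blast
  have ext: "extreme_points ?B \<subseteq> ?B"
    unfolding extreme_points_def extreme_point_of_def by blast
  have "\<exists>E\<in>extreme_points ?B. ?h E = ?h P"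
  proof (rule ccontr)
    assume none: "\<not> (\<exists>E\<in>extreme_points ?B. ?h E = ?h P)"
    \<comment> \<open>A strict sublevel set is convex; if it contained every extreme point, it would contain
      all of \<open>?B\<close>, and in particular the maximiser itself.\<close>
    let ?L = "{R \<in> ?B. ?h R < ?h P}"
    have "convex ?L"
    proof (rule convexI)
      fix R S and a b :: real
      assume RS: "R \<in> ?L" "S \<in> ?L" and ab: "0 \<le> a" "0 \<le> b" "a + b = 1"
      have "0 \<le> ?h (R - S)"
        using RS by (intro gw_functional_nonneg[OF sym diag assms(3,4)])
          (auto simp: bistochastic_def sum_subtractf)
      then have "?h (a *\<^sub>R R + b *\<^sub>R S) \<le> a * ?h R + b * ?h S"
        using ab by (simp add: gw_functional_segment)
      also have "\<dots> < ?h P"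
        using RS ab by (intro convex_bound_lt) auto
      finally have "?h (a *\<^sub>R R + b *\<^sub>R S) < ?h P" .
      moreover have "a *\<^sub>R R + b *\<^sub>R S \<in> ?B"
        using RS ab by (intro convexD[OF convex_bistochastic]) auto
      ultimately show "a *\<^sub>R R + b *\<^sub>R S \<in> ?L" by blast
    qed
    moreover have "extreme_points ?B \<subseteq> ?L"
    proof
      fix E assume E: "E \<in> extreme_points ?B"
      then have "E \<in> ?B" using ext by blast
      moreover have "?h E \<noteq> ?h P" using none E by blast
      ultimately show "E \<in> ?L" using P(2)[of E] by simp
    qed
    ultimately have "convex hull extreme_points ?B \<subseteq> ?L"
      by (rule hull_minimal[rotated])
    with Krein_Milman_Minkowski[OF compact_bistochastic convex_bistochastic]
    have "?B \<subseteq> ?L"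
      unfolding extreme_points_def by (rule ord_eq_le_trans)
    then have "P \<in> ?L" using P(1) by (rule subsetD)
    then show False by simp
  qed
  then have "has_maximum_on ?h (extreme_points ?B) (?h P)"
    unfolding has_maximum_on_def using P(2) ext by blast
  moreover have "has_maximum_on ?h ?B (?h P)"
    unfolding has_maximum_on_def using P by blast
  ultimately show ?thesis by blast
qed

end
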